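(* Let $A$ be any mv-algebra. Then the morphism of mv-algebras $$\eta: A \to \Gamma(Z_A, E_A),\qquad \eta(a) = \widehat{a},\qquad \widehat{a}(P) = [a]_P,$$ from $A$ to the mv-algebra of global sections of its prime spectrum $E_A \to Z_A$ is an isomorphism.
   Context: An mv-algebra is a set $A$ with a binary operation $\oplus$, a unary operation $\neg$ and a constant $0$ such that $(A,\oplus,0)$ is a commutative monoid, $\neg\neg x = x$, $x\oplus\neg 0=\neg 0$ and $\neg(\neg x\oplus y)\oplus y=\neg(\neg y\oplus x)\oplus x$ (the trivial algebra $\{0\}$ is allowed). Derived operations: $1=\neg 0$, $x\odot y=\neg(\neg x\oplus\neg y)$, $x\ominus y=x\odot\neg y$, $d(x,y)=(x\ominus y)\oplus(y\ominus x)$. The relation $x\le y \iff x\ominus y=0$ is a lattice order. An ideal is a subset $I\subset A$ containing $0$, downward closed, and closed under $\oplus$. The quotient $A/I$ is taken by the congruence $x\sim y\iff d(x,y)\in I$, and $[x]_I$ is the class of $x$. An ideal $P$ is prime if $1\notin P$ and for all $x,y\in A$, $x\ominus y\in P$ or $y\ominus x\in P$. The prime spectrum: $Z_A$ is the set of all prime ideals of $A$ with the coZariski topology, whose open base is given by the sets $W_a=\{P\in Z_A : a\in P\}$, $a\in A$. $E_A$ is the disjoint union of the quotients $A/P$, $P\in Z_A$, with projection $\pi:E_A\to Z_A$. Each $a\in A$ gives a section $\widehat a(P)=[a]_P\in A/P$, and $E_A$ has as open base the image sets $\widehat a(W_b)$, $a,b\in A$; then $\pi$ is a local homeomorphism.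 $\Gamma(Z_A,E_A)$ is the mv-algebra (with pointwise operations) of continuous global sections of $\pi$; equivalently, of the functions $\sigma$ with $\sigma(P)\in A/P$ such that for each $P\in Z_A$ there are $s\in A$ and $b\in P$ with $\sigma(Q)=[s]_Q$ for all prime $Q\ni b$. *)

theory Defs
  imports "HOL-Algebra.Congruence" "HOL-Analysis.Abstract_Topology"
begin

record 'a mv = "'a partial_object" +
  mv_plus :: "'a \<Rightarrow> 'a \<Rightarrow> 'a" (infixl \<open>\<oplus>\<index>\<close> 65)
  mv_neg :: "'a \<Rightarrow> 'a" (\<open>\<^bold>\<not>\<index> _\<close> [81] 80)
  mv_zero :: "'a" (\<open>\<zero>\<index>\<close>)

locale mv_algebra =
  fixes A (structure)
  assumes plus_closed: "\<lbrakk>x \<in> carrier A; y \<in> carrier A\<rbrakk> \<Longrightarrow> x \<oplus> y \<in> carrier A"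
    and neg_closed: "x \<in> carrier A \<Longrightarrow> \<^bold>\<not> x \<in> carrier A"
    and zero_closed: "\<zero> \<in> carrier A"
    and plus_assoc: "\<lbrakk>x \<in> carrier A; y \<in> carrier A; z \<in> carrier A\<rbrakk> \<Longrightarrow> (x \<oplus> y) \<oplus> z = x \<oplus> (y \<oplus> z)"
    and plus_comm: "\<lbrakk>x \<in> carrier A; y \<in> carrier A\<rbrakk> \<Longrightarrow> x \<oplus> y = y \<oplus> x"
    and plus_zero: "x \<in> carrier A \<Longrightarrow> x \<oplus> \<zero> = x"
    and neg_neg: "x \<in> carrier A \<Longrightarrow> \<^bold>\<not> (\<^bold>\<not> x) = x"
    and plus_neg_zero: "x \<in> carrier A \<Longrightarrow> x \<oplus> \<^bold>\<not> \<zero> = \<^bold>\<not> \<zero>"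
    and luk: "\<lbrakk>x \<in> carrier A; y \<in> carrier A\<rbrakk> \<Longrightarrow>
      \<^bold>\<not> (\<^bold>\<not> x \<oplus> y) \<oplus> y = \<^bold>\<not> (\<^bold>\<not> y \<oplus> x) \<oplus> x"

definition mv_hom :: "('a, 'm) mv_scheme \<Rightarrow> ('b, 'n) mv_scheme \<Rightarrow> ('a \<Rightarrow> 'b) set" where
  "mv_hom A B = {h. h \<in> carrier A \<rightarrow> carrier B \<and>
     (\<forall>x\<in>carrier A. \<forall>y\<in>carrier A. h (x \<oplus>\<^bsub>A\<^esub> y) = h x \<oplus>\<^bsub>B\<^esub> h y) \<and>
     (\<forall>x\<in>carrier A. h (\<^bold>\<not>\<^bsub>A\<^esub> x) = \<^bold>\<not>\<^bsub>B\<^esub> h x) \<and>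
     h \<zero>\<^bsub>A\<^esub> = \<zero>\<^bsub>B\<^esub>}"

definition mv_iso :: "('a, 'm) mv_scheme \<Rightarrow> ('b, 'n) mv_scheme \<Rightarrow> ('a \<Rightarrow> 'b) set" where
  "mv_iso A B = {h \<in> mv_hom A B. bij_betw h (carrier A) (carrier B)}"

definition mv_one :: "('a, 'm) mv_scheme \<Rightarrow> 'a" (\<open>\<one>\<index>\<close>) where
  "\<one>\<^bsub>A\<^esub> = \<^bold>\<not>\<^bsub>A\<^esub> \<zero>\<^bsub>A\<^esub>"

definition mv_times :: "('a, 'm) mv_scheme \<Rightarrow> 'a \<Rightarrow> 'a \<Rightarrow> 'a" (infixl \<open>\<odot>\<index>\<close> 70) where
  "x \<odot>\<^bsub>A\<^esub> y = \<^bold>\<not>\<^bsub>A\<^esub> (\<^bold>\<not>\<^bsub>A\<^esub> x \<oplus>\<^bsub>A\<^esub> \<^bold>\<not>\<^bsub>A\<^esub> y)"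

definition mv_minus :: "('a, 'm) mv_scheme \<Rightarrow> 'a \<Rightarrow> 'a \<Rightarrow> 'a" (infixl \<open>\<ominus>\<index>\<close> 65) where
  "x \<ominus>\<^bsub>A\<^esub> y = x \<odot>\<^bsub>A\<^esub> \<^bold>\<not>\<^bsub>A\<^esub> y"

definition mv_dist :: "('a, 'm) mv_scheme \<Rightarrow> 'a \<Rightarrow> 'a \<Rightarrow> 'a" where
  "mv_dist A x y = (x \<ominus>\<^bsub>A\<^esub> y) \<oplus>\<^bsub>A\<^esub> (y \<ominus>\<^bsub>A\<^esub> x)"

definition mv_le :: "('a, 'm) mv_scheme \<Rightarrow> 'a \<Rightarrow> 'a \<Rightarrow> bool" where
  "mv_le A x y \<longleftrightarrow> x \<ominus>\<^bsub>A\<^esub> y = \<zero>\<^bsub>A\<^esub>"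

definition mv_ideal :: "('a, 'm) mv_scheme \<Rightarrow> 'a set \<Rightarrow> bool" where
  "mv_ideal A I \<longleftrightarrow> I \<subseteq> carrier A \<and> \<zero>\<^bsub>A\<^esub> \<in> I \<and>
     (\<forall>x\<in>carrier A. \<forall>y\<in>I. mv_le A x y \<longrightarrow> x \<in> I) \<and>
     (\<forall>x\<in>I. \<forall>y\<in>I. x \<oplus>\<^bsub>A\<^esub> y \<in> I)"

definition mv_prime_ideal :: "('a, 'm) mv_scheme \<Rightarrow> 'a set \<Rightarrow> bool" where
  "mv_prime_ideal A P \<longleftrightarrow> mv_ideal A P \<and> \<one>\<^bsub>A\<^esub> \<notin> P \<and>
     (\<forall>x\<in>carrier A. \<forall>y\<in>carrier A. x \<ominus>\<^bsub>A\<^esub> y \<in> P \<or> y \<ominus>\<^bsub>A\<^esub> x \<in> P)"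

definition mv_cong :: "('a, 'm) mv_scheme \<Rightarrow> 'a set \<Rightarrow> 'a rel" where
  "mv_cong A I = {(x, y). x \<in> carrier A \<and> y \<in> carrier A \<and> mv_dist A x y \<in> I}"

definition mv_class :: "('a, 'm) mv_scheme \<Rightarrow> 'a set \<Rightarrow> 'a \<Rightarrow> 'a set" where
  "mv_class A I x = mv_cong A I `` {x}"

text \<open>Since \<^term>\<open>mv_cong A I\<close> is a congruence for an ideal \<^term>\<open>I\<close>, the unions below
  are unions of copies of one and the same class, namely \<open>[x \<oplus> y]\<close> and \<open>[\<not> x]\<close> for any
  representatives \<open>x\<close>, \<open>y\<close>.\<close>

definition mv_quot :: "('a, 'm) mv_scheme \<Rightarrow> 'a set \<Rightarrow> 'a set mv" where
  "mv_quot A I = \<lparr>carrier = carrier A // mv_cong A I,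
     mv_plus = (\<lambda>X Y. \<Union>x\<in>X. \<Union>y\<in>Y. mv_class A I (x \<oplus>\<^bsub>A\<^esub> y)),
     mv_neg = (\<lambda>X. \<Union>x\<in>X. mv_class A I (\<^bold>\<not>\<^bsub>A\<^esub> x)),
     mv_zero = mv_class A I \<zero>\<^bsub>A\<^esub>\<rparr>"

definition mv_spec :: "('a, 'm) mv_scheme \<Rightarrow> 'a set set" where
  "mv_spec A = {P. mv_prime_ideal A P}"

definition mv_W :: "('a, 'm) mv_scheme \<Rightarrow> 'a \<Rightarrow> 'a set set" where
  "mv_W A a = {P \<in> mv_spec A. a \<in> P}"

text \<open>The generating families of the two topologies below are closed under binary intersection
  and cover the respective spaces, so they are bases of the topologies they generate:
  \<open>W a \<inter> W b = W (a \<oplus> b)\<close>, and the sections \<open>a\<close> and \<open>c\<close> agree exactly on \<open>W (d a c)\<close>.\<close>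

definition mv_spec_topology :: "('a, 'm) mv_scheme \<Rightarrow> 'a set topology" where
  "mv_spec_topology A = topology_generated_by {mv_W A a | a. a \<in> carrier A}"

text \<open>A point of the fibre over \<open>P\<close> is tagged with \<open>P\<close>, which makes the union of the fibres
  disjoint; the projection is \<^const>\<open>fst\<close>.\<close>

definition mv_etale :: "('a, 'm) mv_scheme \<Rightarrow> ('a set \<times> 'a set) set" where
  "mv_etale A = (SIGMA P:mv_spec A. carrier (mv_quot A P))"

definition mv_proj :: "'a set \<times> 'a set \<Rightarrow> 'a set" where
  "mv_proj = fst"

definition mv_hat :: "('a, 'm) mv_scheme \<Rightarrow> 'a \<Rightarrow> 'a set \<Rightarrow> 'a set \<times> 'a set" where
  "mv_hat A a = (\<lambda>P\<in>mv_spec A. (P, mv_class A P a))"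

definition mv_etale_topology :: "('a, 'm) mv_scheme \<Rightarrow> ('a set \<times> 'a set) topology" where
  "mv_etale_topology A =
     topology_generated_by {mv_hat A a ` mv_W A b | a b. a \<in> carrier A \<and> b \<in> carrier A}"

text \<open>Sections are taken extensional, so that equality of sections is equality on the spectrum.
  The operations act on each fibre by the operations of the quotient.\<close>

definition mv_sections :: "('a, 'm) mv_scheme \<Rightarrow> ('a set \<Rightarrow> 'a set \<times> 'a set) mv" where
  "mv_sections A = \<lparr>
     carrier = {\<sigma> \<in> extensional (mv_spec A).
       continuous_map (mv_spec_topology A) (mv_etale_topology A) \<sigma> \<and>
       (\<forall>P\<in>mv_spec A. mv_proj (\<sigma> P) = P)},
     mv_plus = (\<lambda>\<sigma> \<tau>. \<lambda>P\<in>mv_spec A. (P, snd (\<sigma> P) \<oplus>\<^bsub>mv_quot A P\<^esub> snd (\<tau> P))),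
     mv_neg = (\<lambda>\<sigma>. \<lambda>P\<in>mv_spec A. (P, \<^bold>\<not>\<^bsub>mv_quot A P\<^esub> snd (\<sigma> P))),
     mv_zero = (\<lambda>P\<in>mv_spec A. (P, \<zero>\<^bsub>mv_quot A P\<^esub>))\<rparr>"

lemma topspace_mv_spec_topology:
  assumes "mv_algebra A"
  shows "topspace (mv_spec_topology A) = mv_spec A"
proof -
  have "\<zero>\<^bsub>A\<^esub> \<in> carrier A" "mv_W A \<zero>\<^bsub>A\<^esub> = mv_spec A"
    using assms by (auto simp: mv_algebra_def mv_W_def mv_spec_def mv_prime_ideal_def mv_ideal_def)
  then show ?thesis
    by (auto simp: mv_spec_topology_def topology_generated_by_topspace mv_W_def)
qed

lemma topspace_mv_etale_topology:
  assumes "mv_algebra A"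
  shows "topspace (mv_etale_topology A) = mv_etale A"
proof -
  have z: "\<zero>\<^bsub>A\<^esub> \<in> carrier A" "mv_W A \<zero>\<^bsub>A\<^esub> = mv_spec A"
    using assms by (auto simp: mv_algebra_def mv_W_def mv_spec_def mv_prime_ideal_def mv_ideal_def)
  have "mv_etale A = (\<Union>a\<in>carrier A. mv_hat A a ` mv_spec A)"
    by (auto simp: mv_etale_def mv_quot_def quotient_def mv_class_def mv_hat_def image_iff)
  also have "\<dots> = \<Union> {mv_hat A a ` mv_W A b | a b. a \<in> carrier A \<and> b \<in> carrier A}"
    (is "?l = ?r")
  proof
    show "?l \<subseteq> ?r" using z by blast
    show "?r \<subseteq> ?l" by (auto simp: mv_W_def)
  qed
  finally show ?thesis
    by (simp add: mv_etale_topology_def topology_generated_by_topspace)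
qed

end

theory Submission
  imports Defs
begin

text \<open>
  Injectivity says that the prime ideals separate the points of \<open>A\<close>; surjectivity says that every
  section, although given by elements of \<open>A\<close> only locally, is given by a single element. Both
  come from one existence statement, \<open>prime_ideal_avoiding\<close>: an ideal disjoint from a nonempty
  set \<open>S\<close> closed under binary meets extends to a prime ideal disjoint from \<open>S\<close>.

  If \<open>[a] = [b]\<close> at every prime, then \<open>d a b\<close> lies in every prime ideal. Were \<open>d a b \<noteq> 0\<close>, the
  ideal \<open>{0}\<close> would extend to a prime ideal avoiding \<open>{d a b}\<close>; hence \<open>d a b = 0\<close> and \<open>a = b\<close>.

  For surjectivity fix a continuous section \<open>\<sigma>\<close> and let \<open>S\<close> be the set of all \<open>b\<close> such that on
  \<open>W b\<close> the section \<open>\<sigma>\<close> is given by one element. Continuity of \<open>\<sigma>\<close> says that every prime ideal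
  meets \<open>S\<close>. As \<open>W (b \<sqinter> c) = W b \<union> W c\<close>, closure of \<open>S\<close> under meets is a gluing
  statement for two elements (\<open>binary_gluing\<close>), which is a Chinese remainder theorem with an
  explicit solution. If \<open>0\<close> were not in \<open>S\<close>, then some prime ideal would avoid \<open>S\<close>; so
  \<open>0 \<in> S\<close>, and \<open>W 0\<close> is the whole spectrum. This replaces an appeal to compactness of
  the spectrum followed by an induction over a finite cover.

  The map \<open>a \<mapsto> mv_hat A a\<close> respects the operations because ideals define congruences. The
  sections then form an mv-algebra because they are a bijective image of one (\<open>mv_algebra_iso_image\<close>); in
  particular, continuity of pointwise sums need not be verified separately.
\<close>

section \<open>Order and lattice structure of an mv-algebra\<close>

context mv_algebra
begin

declare plus_closed [simp, intro] neg_closed [simp, intro] zero_closed [simp, intro]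
  neg_neg [simp] plus_zero [simp]

abbreviation le (infix \<open>\<sqsubseteq>\<close> 50) where "x \<sqsubseteq> y \<equiv> mv_le A x y"

definition join (infixl \<open>\<squnion>\<close> 65) where "x \<squnion> y = (x \<ominus> y) \<oplus> y"

definition meet (infixl \<open>\<sqinter>\<close> 70) where "x \<sqinter> y = \<^bold>\<not> (\<^bold>\<not> x \<squnion> \<^bold>\<not> y)"

lemma one_closed [simp, intro]: "\<one> \<in> carrier A"
  by (simp add: mv_one_def)

lemma minus_eq: "\<lbrakk>x \<in> carrier A; y \<in> carrier A\<rbrakk> \<Longrightarrow> x \<ominus> y = \<^bold>\<not> (\<^bold>\<not> x \<oplus> y)"
  by (simp add: mv_minus_def mv_times_def)

lemma minus_closed [simp, intro]: "\<lbrakk>x \<in> carrier A; y \<in> carrier A\<rbrakk> \<Longrightarrow> x \<ominus> y \<in> carrier A"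
  by (simp add: minus_eq)

lemma join_closed [simp, intro]: "\<lbrakk>x \<in> carrier A; y \<in> carrier A\<rbrakk> \<Longrightarrow> x \<squnion> y \<in> carrier A"
  by (simp add: join_def)

lemma meet_closed [simp, intro]: "\<lbrakk>x \<in> carrier A; y \<in> carrier A\<rbrakk> \<Longrightarrow> x \<sqinter> y \<in> carrier A"
  by (simp add: meet_def)

lemma dist_closed [simp, intro]: "\<lbrakk>x \<in> carrier A; y \<in> carrier A\<rbrakk> \<Longrightarrow> mv_dist A x y \<in> carrier A"
  by (simp add: mv_dist_def)

lemma zero_plus [simp]: "x \<in> carrier A \<Longrightarrow> \<zero> \<oplus> x = x"
  using plus_comm [of \<zero> x] by simp

lemma plus_one [simp]: "x \<in> carrier A \<Longrightarrow> x \<oplus> \<one> = \<one>"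
  by (simp add: mv_one_def plus_neg_zero)

lemma neg_eq_zero_iff: "x \<in> carrier A \<Longrightarrow> \<^bold>\<not> x = \<zero> \<longleftrightarrow> x = \<one>"
  unfolding mv_one_def by (metis neg_neg zero_closed)

lemma plus_left_comm:
  "\<lbrakk>x \<in> carrier A; y \<in> carrier A; z \<in> carrier A\<rbrakk> \<Longrightarrow> x \<oplus> (y \<oplus> z) = y \<oplus> (x \<oplus> z)"
  by (metis plus_assoc plus_comm)

lemmas plus_ac = plus_assoc plus_comm plus_left_comm

lemma le_iff: "\<lbrakk>x \<in> carrier A; y \<in> carrier A\<rbrakk> \<Longrightarrow> x \<sqsubseteq> y \<longleftrightarrow> \<^bold>\<not> x \<oplus> y = \<one>"
  by (simp add: mv_le_def minus_eq neg_eq_zero_iff)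

text \<open>Truncated subtraction is the residual of addition. Nearly all inequalities below are
  obtained by moving terms across this adjunction.\<close>

lemma minus_le_iff:
  "\<lbrakk>x \<in> carrier A; y \<in> carrier A; z \<in> carrier A\<rbrakk> \<Longrightarrow> x \<ominus> y \<sqsubseteq> z \<longleftrightarrow> x \<sqsubseteq> y \<oplus> z"
  by (simp add: le_iff minus_eq plus_assoc)

lemma neg_plus_self: "x \<in> carrier A \<Longrightarrow> \<^bold>\<not> x \<oplus> x = \<one>"
  using luk [of x \<one>] by (simp add: mv_one_def plus_neg_zero)

lemma le_refl [simp]: "x \<in> carrier A \<Longrightarrow> x \<sqsubseteq> x"
  by (simp add: le_iff neg_plus_self)

lemma join_comm: "\<lbrakk>x \<in> carrier A; y \<in> carrier A\<rbrakk> \<Longrightarrow> x \<squnion> y = y \<squnion> x"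
  by (simp add: join_def minus_eq luk)

lemma join_absorb: "\<lbrakk>x \<sqsubseteq> y; y \<in> carrier A\<rbrakk> \<Longrightarrow> x \<squnion> y = y"
  by (simp add: join_def mv_le_def)

lemma le_antisym: "\<lbrakk>x \<sqsubseteq> y; y \<sqsubseteq> x; x \<in> carrier A; y \<in> carrier A\<rbrakk> \<Longrightarrow> x = y"
  by (metis join_absorb join_comm)

lemma le_plus_left: "\<lbrakk>x \<in> carrier A; y \<in> carrier A\<rbrakk> \<Longrightarrow> x \<sqsubseteq> y \<oplus> x"
  by (simp add: le_iff plus_left_comm neg_plus_self)

lemma le_plus_right: "\<lbrakk>x \<in> carrier A; y \<in> carrier A\<rbrakk> \<Longrightarrow> x \<sqsubseteq> x \<oplus> y"
  by (metis le_plus_left plus_comm)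

lemma le_decompose: "\<lbrakk>x \<sqsubseteq> y; x \<in> carrier A; y \<in> carrier A\<rbrakk> \<Longrightarrow> y = (y \<ominus> x) \<oplus> x"
  by (metis join_absorb join_comm join_def)

lemma le_trans [trans]:
  assumes "x \<sqsubseteq> y" "y \<sqsubseteq> z" "x \<in> carrier A" "y \<in> carrier A" "z \<in> carrier A"
  shows "x \<sqsubseteq> z"
proof -
  have "z = (z \<ominus> y) \<oplus> ((y \<ominus> x) \<oplus> x)"
    using le_decompose [of y z] le_decompose [of x y] assms by simp
  also have "\<dots> = ((z \<ominus> y) \<oplus> (y \<ominus> x)) \<oplus> x"
    using assms by (simp add: plus_assoc)
  finally show ?thesis
    using le_plus_left [of x "(z \<ominus> y) \<oplus> (y \<ominus> x)"] assms by simp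
qed

lemma plus_mono_left:
  assumes "x \<sqsubseteq> y" "x \<in> carrier A" "y \<in> carrier A" "z \<in> carrier A"
  shows "x \<oplus> z \<sqsubseteq> y \<oplus> z"
proof -
  have "y \<oplus> z = (y \<ominus> x) \<oplus> (x \<oplus> z)"
    using le_decompose [of x y] assms by (metis minus_closed plus_assoc)
  then show ?thesis
    using le_plus_left [of "x \<oplus> z" "y \<ominus> x"] assms by simp
qed

lemma plus_mono:
  assumes "x \<sqsubseteq> y" "x' \<sqsubseteq> y'"
    and "x \<in> carrier A" "y \<in> carrier A" "x' \<in> carrier A" "y' \<in> carrier A"
  shows "x \<oplus> x' \<sqsubseteq> y \<oplus> y'"
proof (rule le_trans)
  show "x \<oplus> x' \<sqsubseteq> y \<oplus> x'"
    using assms by (simp add: plus_mono_left)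
  show "y \<oplus> x' \<sqsubseteq> y \<oplus> y'"
    using plus_mono_left [of x' y' y] assms by (simp add: plus_comm)
qed (use assms in auto)

lemma join_upper2: "\<lbrakk>x \<in> carrier A; y \<in> carrier A\<rbrakk> \<Longrightarrow> y \<sqsubseteq> x \<squnion> y"
  by (simp add: join_def le_plus_left)

lemma join_upper1: "\<lbrakk>x \<in> carrier A; y \<in> carrier A\<rbrakk> \<Longrightarrow> x \<sqsubseteq> x \<squnion> y"
  using join_upper2 [of y x] join_comm by simp

lemma le_plus_minus: "\<lbrakk>x \<in> carrier A; y \<in> carrier A\<rbrakk> \<Longrightarrow> x \<sqsubseteq> y \<oplus> (x \<ominus> y)"
  using minus_le_iff [of x y "x \<ominus> y"] by simp

lemma minus_le: "\<lbrakk>x \<in> carrier A; y \<in> carrier A\<rbrakk> \<Longrightarrow> x \<ominus> y \<sqsubseteq> x"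
  by (simp add: minus_le_iff le_plus_left)

lemma minus_mono_left:
  assumes "x \<sqsubseteq> z" "x \<in> carrier A" "y \<in> carrier A" "z \<in> carrier A"
  shows "x \<ominus> y \<sqsubseteq> z \<ominus> y"
  using assms le_trans [OF assms(1) le_plus_minus [of z y]] by (simp add: minus_le_iff)

lemma join_least:
  assumes "x \<sqsubseteq> z" "y \<sqsubseteq> z" "x \<in> carrier A" "y \<in> carrier A" "z \<in> carrier A"
  shows "x \<squnion> y \<sqsubseteq> z"
proof -
  have "x \<squnion> y \<sqsubseteq> (z \<ominus> y) \<oplus> y"
    unfolding join_def using assms by (intro plus_mono_left minus_mono_left) auto
  then show ?thesis
    using le_decompose [of y z] assms by simp
qed

lemma neg_le_neg_iff: "\<lbrakk>x \<in> carrier A; y \<in> carrier A\<rbrakk> \<Longrightarrow> \<^bold>\<not> y \<sqsubseteq> \<^bold>\<not> x \<longleftrightarrow> x \<sqsubseteq> y"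
  by (simp add: le_iff plus_comm)

lemma neg_minus_neg: "\<lbrakk>x \<in> carrier A; y \<in> carrier A\<rbrakk> \<Longrightarrow> \<^bold>\<not> x \<ominus> \<^bold>\<not> y = y \<ominus> x"
  by (simp add: minus_eq plus_comm)

lemma meet_lower1: "\<lbrakk>x \<in> carrier A; y \<in> carrier A\<rbrakk> \<Longrightarrow> x \<sqinter> y \<sqsubseteq> x"
  using neg_le_neg_iff [of "x \<sqinter> y" x] join_upper1 [of "\<^bold>\<not> x" "\<^bold>\<not> y"] by (simp add: meet_def)

lemma meet_lower2: "\<lbrakk>x \<in> carrier A; y \<in> carrier A\<rbrakk> \<Longrightarrow> x \<sqinter> y \<sqsubseteq> y"
  using neg_le_neg_iff [of "x \<sqinter> y" y] join_upper2 [of "\<^bold>\<not> x" "\<^bold>\<not> y"] by (simp add: meet_def)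

lemma meet_greatest:
  assumes "w \<sqsubseteq> x" "w \<sqsubseteq> y" "w \<in> carrier A" "x \<in> carrier A" "y \<in> carrier A"
  shows "w \<sqsubseteq> x \<sqinter> y"
  using neg_le_neg_iff [of w "x \<sqinter> y"] join_least [of "\<^bold>\<not> x" "\<^bold>\<not> w" "\<^bold>\<not> y"] assms
  by (simp add: meet_def neg_le_neg_iff)

lemma meet_comm: "\<lbrakk>x \<in> carrier A; y \<in> carrier A\<rbrakk> \<Longrightarrow> x \<sqinter> y = y \<sqinter> x"
  by (simp add: meet_def join_comm)

lemma meet_idem: "x \<in> carrier A \<Longrightarrow> x \<sqinter> x = x"
  by (intro le_antisym meet_lower1 meet_greatest) auto

lemma zero_le [simp]: "x \<in> carrier A \<Longrightarrow> \<zero> \<sqsubseteq> x"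
  using le_plus_right [of \<zero> x] by simp

lemma le_one [simp]: "x \<in> carrier A \<Longrightarrow> x \<sqsubseteq> \<one>"
  by (simp add: le_iff)

lemma le_plus_meet:
  assumes "w \<sqsubseteq> a \<oplus> b" "w \<sqsubseteq> a \<oplus> c" 
    and "w \<in> carrier A" "a \<in> carrier A" "b \<in> carrier A" "c \<in> carrier A"
  shows "w \<sqsubseteq> a \<oplus> b \<sqinter> c"
  using meet_greatest [of "w \<ominus> a" b c] assms by (simp add: minus_le_iff)

lemma plus_meet_subdistrib:
  assumes "x \<in> carrier A" "y \<in> carrier A" "z \<in> carrier A"
  shows "(x \<oplus> y) \<sqinter> z \<sqsubseteq> x \<sqinter> z \<oplus> y \<sqinter> z"
proof (rule le_plus_meet)
  let ?w = "(x \<oplus> y) \<sqinter> z"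
  have z: "?w \<sqsubseteq> u \<oplus> z" if "u \<in> carrier A" for u
    using le_trans [OF meet_lower2 le_plus_left, of "x \<oplus> y" z u] assms that by simp
  then show "?w \<sqsubseteq> x \<sqinter> z \<oplus> z"
    using assms by simp
  have "?w \<sqsubseteq> y \<oplus> x \<sqinter> z"
    using z meet_lower1 [of "x \<oplus> y" z] assms by (intro le_plus_meet) (auto simp: plus_comm)
  then show "?w \<sqsubseteq> x \<sqinter> z \<oplus> y"
    using assms by (simp add: plus_comm)
qed (use assms in auto)

text \<open>With \<open>m = x \<sqinter> y\<close> the two differences are \<open>x \<ominus> m\<close> and \<open>y \<ominus> m\<close>, so a common lower bound
  \<open>w\<close> of both satisfies \<open>w \<oplus> m \<sqsubseteq> x \<sqinter> y = m\<close>. Since \<open>w \<sqsubseteq> \<not> m\<close>, this sum is not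
  truncated, and \<open>w = 0\<close> follows.\<close>

lemma minus_meet_minus:
  assumes x: "x \<in> carrier A" and y: "y \<in> carrier A"
  shows "(x \<ominus> y) \<sqinter> (y \<ominus> x) = \<zero>"
proof -
  define m where "m = x \<sqinter> y"
  define w where "w = (x \<ominus> y) \<sqinter> (y \<ominus> x)"
  have m: "m \<in> carrier A" "m \<sqsubseteq> x" "m \<sqsubseteq> y" and w: "w \<in> carrier A"
    using x y by (auto simp: m_def w_def meet_lower1 meet_lower2)
  have bound: "w \<sqsubseteq> u \<ominus> m" if u: "u = x \<or> u = y" for u
  proof -
    define v where "v = (if u = x then y else x)"
    have uv: "u \<in> carrier A" "v \<in> carrier A" "w \<sqsubseteq> u \<ominus> v" "m \<sqsubseteq> v"
      using u x y m by (auto simp: v_def w_def meet_lower1 meet_lower2)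
    have "u \<sqsubseteq> m \<oplus> (u \<ominus> m)"
      using uv m by (simp add: le_plus_minus)
    also have "\<dots> \<sqsubseteq> v \<oplus> (u \<ominus> m)"
      using uv m by (intro plus_mono) auto
    finally have "u \<ominus> v \<sqsubseteq> u \<ominus> m"
      using uv m by (simp add: minus_le_iff)
    then show ?thesis
      using uv m w le_trans [of w "u \<ominus> v" "u \<ominus> m"] by simp
  qed
  have "w \<oplus> m \<sqsubseteq> u" if u: "u = x \<or> u = y" for u
    using plus_mono_left [OF bound [OF u], of m] le_decompose [of m u] u m w x y by auto
  then have wm: "w \<oplus> m \<sqsubseteq> m"
    unfolding m_def [symmetric] using x y m w by (subst (2) m_def, intro meet_greatest) auto
  have "m \<sqsubseteq> \<^bold>\<not> w"
  proof -
    have "x \<ominus> m \<sqsubseteq> \<^bold>\<not> m"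
      using x m by (simp add: minus_le_iff plus_comm [of m] neg_plus_self)
    then have "w \<sqsubseteq> \<^bold>\<not> m"
      using bound [of x] x m w le_trans [of w "x \<ominus> m" "\<^bold>\<not> m"] by simp
    then show ?thesis
      using neg_le_neg_iff [of w "\<^bold>\<not> m"] m w by simp
  qed
  moreover have "\<^bold>\<not> w \<squnion> m = \<one>"
    using wm m w by (simp add: join_def minus_eq le_iff)
  ultimately have "\<^bold>\<not> w = \<one>"
    using join_absorb [of m "\<^bold>\<not> w"] join_comm m w by simp
  then show ?thesis
    using neg_neg [OF w] neg_eq_zero_iff [of \<one>] by (simp add: w_def)
qed

section \<open>Ideals and their congruences\<close>

lemma ideal_subset: "\<lbrakk>mv_ideal A I; x \<in> I\<rbrakk> \<Longrightarrow> x \<in> carrier A"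
  by (auto simp: mv_ideal_def)

lemma ideal_zero: "mv_ideal A I \<Longrightarrow> \<zero> \<in> I"
  by (simp add: mv_ideal_def)

lemma ideal_down: "\<lbrakk>mv_ideal A I; y \<in> I; x \<sqsubseteq> y; x \<in> carrier A\<rbrakk> \<Longrightarrow> x \<in> I"
  by (auto simp: mv_ideal_def)

lemma ideal_plus: "\<lbrakk>mv_ideal A I; x \<in> I; y \<in> I\<rbrakk> \<Longrightarrow> x \<oplus> y \<in> I"
  by (simp add: mv_ideal_def)

lemma zero_ideal: "mv_ideal A {\<zero>}"
  using le_antisym by (auto simp: mv_ideal_def)

lemma ideal_plus_iff:
  "\<lbrakk>mv_ideal A I; x \<in> carrier A; y \<in> carrier A\<rbrakk> \<Longrightarrow> x \<oplus> y \<in> I \<longleftrightarrow> x \<in> I \<and> y \<in> I"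
  by (meson ideal_down ideal_plus le_plus_left le_plus_right)

lemma dist_in_ideal_iff:
  "\<lbrakk>mv_ideal A I; x \<in> carrier A; y \<in> carrier A\<rbrakk> \<Longrightarrow>
    mv_dist A x y \<in> I \<longleftrightarrow> x \<ominus> y \<in> I \<and> y \<ominus> x \<in> I"
  by (simp add: mv_dist_def ideal_plus_iff)

lemma minus_self: "x \<in> carrier A \<Longrightarrow> x \<ominus> x = \<zero>"
  using le_refl [of x] by (simp add: mv_le_def)

lemma minus_triangle:
  assumes "x \<in> carrier A" "y \<in> carrier A" "z \<in> carrier A"
  shows "x \<ominus> z \<sqsubseteq> (x \<ominus> y) \<oplus> (y \<ominus> z)"
proof -
  have "x \<sqsubseteq> y \<oplus> (x \<ominus> y)"
    using assms by (simp add: le_plus_minus)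
  also have "\<dots> \<sqsubseteq> (z \<oplus> (y \<ominus> z)) \<oplus> (x \<ominus> y)"
    using assms by (intro plus_mono_left le_plus_minus) auto
  finally show ?thesis
    using assms by (simp add: minus_le_iff plus_ac)
qed

lemma plus_minus_plus:
  assumes "x \<in> carrier A" "x' \<in> carrier A" "y \<in> carrier A" "y' \<in> carrier A"
  shows "(x \<oplus> y) \<ominus> (x' \<oplus> y') \<sqsubseteq> (x \<ominus> x') \<oplus> (y \<ominus> y')"
proof -
  have "x \<oplus> y \<sqsubseteq> (x' \<oplus> (x \<ominus> x')) \<oplus> (y' \<oplus> (y \<ominus> y'))"
    using assms by (intro plus_mono le_plus_minus) auto
  then show ?thesis
    using assms by (simp add: minus_le_iff plus_ac)
qed

lemma equiv_mv_cong:
  assumes I: "mv_ideal A I"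
  shows "equiv (carrier A) (mv_cong A I)"
proof (rule equivI)
  show "mv_cong A I \<subseteq> carrier A \<times> carrier A"
    by (auto simp: mv_cong_def)
  show "refl_on (carrier A) (mv_cong A I)"
    using I by (auto simp: refl_on_def mv_cong_def dist_in_ideal_iff minus_self ideal_zero)
  show "sym (mv_cong A I)"
    using I by (auto simp: sym_def mv_cong_def dist_in_ideal_iff)
  show "trans (mv_cong A I)"
  proof (rule transI)
    fix x y z
    assume "(x, y) \<in> mv_cong A I" "(y, z) \<in> mv_cong A I"
    then have c: "x \<in> carrier A" "y \<in> carrier A" "z \<in> carrier A"
      and d: "x \<ominus> y \<in> I" "y \<ominus> x \<in> I" "y \<ominus> z \<in> I" "z \<ominus> y \<in> I"
      using I by (auto simp: mv_cong_def dist_in_ideal_iff)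
    have "x \<ominus> z \<in> I"
      using ideal_down [OF I ideal_plus [OF I d(1,3)] minus_triangle] c by simp
    moreover have "z \<ominus> x \<in> I"
      using ideal_down [OF I ideal_plus [OF I d(4,2)] minus_triangle] c by simp
    ultimately show "(x, z) \<in> mv_cong A I"
      using I c by (simp add: mv_cong_def dist_in_ideal_iff)
  qed
qed

lemma mv_class_eq_iff:
  assumes "mv_ideal A I" "x \<in> carrier A" "y \<in> carrier A"
  shows "mv_class A I x = mv_class A I y \<longleftrightarrow> mv_dist A x y \<in> I"
  using eq_equiv_class_iff [OF equiv_mv_cong [OF assms(1)]] assms
  by (simp add: mv_class_def mv_cong_def)

lemma mem_mv_class_iff:
  "x \<in> carrier A \<Longrightarrow> y \<in> mv_class A I x \<longleftrightarrow> y \<in> carrier A \<and> mv_dist A x y \<in> I"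
  by (auto simp: mv_class_def mv_cong_def)

lemma self_mem_mv_class: "\<lbrakk>mv_ideal A I; x \<in> carrier A\<rbrakk> \<Longrightarrow> x \<in> mv_class A I x"
  by (simp add: mem_mv_class_iff dist_in_ideal_iff minus_self ideal_zero)

lemma mv_quot_plus_class:
  assumes I: "mv_ideal A I" and a: "a \<in> carrier A" and b: "b \<in> carrier A"
  shows "mv_class A I a \<oplus>\<^bsub>mv_quot A I\<^esub> mv_class A I b = mv_class A I (a \<oplus> b)"
proof -
  have "mv_class A I (x \<oplus> y) = mv_class A I (a \<oplus> b)"
    if "x \<in> mv_class A I a" "y \<in> mv_class A I b" for x y
  proof -
    have c: "x \<in> carrier A" "y \<in> carrier A"
      and d: "x \<ominus> a \<in> I" "a \<ominus> x \<in> I" "y \<ominus> b \<in> I" "b \<ominus> y \<in> I"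
      using that I a b by (auto simp: mem_mv_class_iff dist_in_ideal_iff)
    have "(x \<oplus> y) \<ominus> (a \<oplus> b) \<in> I"
      using ideal_down [OF I ideal_plus [OF I d(1,3)] plus_minus_plus] c a b by simp
    moreover have "(a \<oplus> b) \<ominus> (x \<oplus> y) \<in> I"
      using ideal_down [OF I ideal_plus [OF I d(2,4)] plus_minus_plus] c a b by simp
    ultimately show ?thesis
      using I c a b by (simp add: mv_class_eq_iff dist_in_ideal_iff)
  qed
  then have "(\<Union>x\<in>mv_class A I a. \<Union>y\<in>mv_class A I b. mv_class A I (x \<oplus> y)) =
      (\<Union>x\<in>mv_class A I a. \<Union>y\<in>mv_class A I b. mv_class A I (a \<oplus> b))"
    by (intro SUP_cong refl)
  also have "\<dots> = mv_class A I (a \<oplus> b)"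
    using self_mem_mv_class [OF I a] self_mem_mv_class [OF I b] by blast
  finally show ?thesis
    by (simp add: mv_quot_def)
qed

lemma mv_quot_neg_class:
  assumes I: "mv_ideal A I" and a: "a \<in> carrier A"
  shows "\<^bold>\<not>\<^bsub>mv_quot A I\<^esub> mv_class A I a = mv_class A I (\<^bold>\<not> a)"
proof -
  have "mv_class A I (\<^bold>\<not> x) = mv_class A I (\<^bold>\<not> a)" if "x \<in> mv_class A I a" for x
    using that I a by (auto simp: mem_mv_class_iff mv_class_eq_iff dist_in_ideal_iff neg_minus_neg)
  then have "(\<Union>x\<in>mv_class A I a. mv_class A I (\<^bold>\<not> x)) =
      (\<Union>x\<in>mv_class A I a. mv_class A I (\<^bold>\<not> a))"
    by (intro SUP_cong refl)
  also have "\<dots> = mv_class A I (\<^bold>\<not> a)"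
    using self_mem_mv_class [OF I a] by blast
  finally show ?thesis
    by (simp add: mv_quot_def)
qed

section \<open>Existence of prime ideals\<close>

text \<open>The colon ideals \<open>I : v\<close> take over the role that the ideals generated by \<open>I\<close> and one more
  element usually play when an ideal is to be enlarged; membership in them needs no multiples.\<close>

lemma colon_ideal:
  assumes I: "mv_ideal A I" and v: "v \<in> carrier A"
  shows "mv_ideal A {z \<in> carrier A. z \<sqinter> v \<in> I}"
  unfolding mv_ideal_def
proof (intro conjI ballI impI)
  show "{z \<in> carrier A. z \<sqinter> v \<in> I} \<subseteq> carrier A"
    by auto
  show "\<zero> \<in> {z \<in> carrier A. z \<sqinter> v \<in> I}"
    using ideal_down [OF I ideal_zero [OF I] meet_lower1] v by simp
next
  fix x y
  assume x: "x \<in> carrier A" and y: "y \<in> {z \<in> carrier A. z \<sqinter> v \<in> I}" and xy: "x \<sqsubseteq> y"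
  have "x \<sqinter> v \<sqsubseteq> y"
    using le_trans [OF meet_lower1 xy] x y v by simp
  then have "x \<sqinter> v \<sqsubseteq> y \<sqinter> v"
    using x y v by (intro meet_greatest) (auto simp: meet_lower2)
  then show "x \<in> {z \<in> carrier A. z \<sqinter> v \<in> I}"
    using ideal_down [OF I, of "y \<sqinter> v"] x y v by simp
next
  fix x y
  assume "x \<in> {z \<in> carrier A. z \<sqinter> v \<in> I}" "y \<in> {z \<in> carrier A. z \<sqinter> v \<in> I}"
  then show "x \<oplus> y \<in> {z \<in> carrier A. z \<sqinter> v \<in> I}"
    using ideal_down [OF I ideal_plus [OF I] plus_meet_subdistrib] v by simp
qed

lemma ideal_Union_chain:
  assumes "C \<noteq> {}" "\<And>J. J \<in> C \<Longrightarrow> mv_ideal A J" 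
    and chain: "\<And>J K. \<lbrakk>J \<in> C; K \<in> C\<rbrakk> \<Longrightarrow> J \<subseteq> K \<or> K \<subseteq> J"
  shows "mv_ideal A (\<Union>C)"
  unfolding mv_ideal_def
proof (intro conjI ballI impI)
  show "\<Union>C \<subseteq> carrier A"
    using assms(2) by (auto dest: ideal_subset)
  show "\<zero> \<in> \<Union>C"
    using assms(1,2) ideal_zero by blast
next
  fix x y assume "x \<in> carrier A" "y \<in> \<Union>C" "x \<sqsubseteq> y"
  then show "x \<in> \<Union>C"
    using assms(2) ideal_down by blast
next
  fix x y assume "x \<in> \<Union>C" "y \<in> \<Union>C"
  then obtain J where "J \<in> C" "x \<in> J" "y \<in> J"
    using chain by blast
  then show "x \<oplus> y \<in> \<Union>C"
    using assms(2) ideal_plus by blast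
qed

text \<open>An ideal \<open>P\<close> that is maximal among those disjoint from \<open>S\<close> is prime. Let \<open>u = x \<ominus> y\<close> and
  \<open>v = y \<ominus> x\<close> both lie outside \<open>P\<close>. As \<open>u \<sqinter> v = 0\<close>, the ideal \<open>P : v\<close> contains \<open>u\<close>, so it
  is larger than \<open>P\<close> and contains some \<open>s \<in> S\<close>. Now \<open>P : s\<close> contains \<open>v\<close>, so it contains some
  \<open>t \<in> S\<close>, and \<open>t \<sqinter> s\<close> lies in both \<open>S\<close> and \<open>P\<close>.\<close>

lemma prime_ideal_avoiding:
  assumes I: "mv_ideal A I" and disj: "I \<inter> S = {}"
    and S: "S \<subseteq> carrier A" "S \<noteq> {}" and S_meet: "\<And>s t. \<lbrakk>s \<in> S; t \<in> S\<rbrakk> \<Longrightarrow> s \<sqinter> t \<in> S"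
  obtains P where "mv_prime_ideal A P" "I \<subseteq> P" "P \<inter> S = {}"
proof -
  define \<F> where "\<F> = {J. mv_ideal A J \<and> I \<subseteq> J \<and> J \<inter> S = {}}"
  have "\<exists>P\<in>\<F>. \<forall>J\<in>\<F>. P \<subseteq> J \<longrightarrow> J = P"
  proof (rule subset_Zorn_nonempty)
    show "\<F> \<noteq> {}"
      using I disj by (auto simp: \<F>_def)
  next
    fix C assume C: "C \<noteq> {}" "subset.chain \<F> C"
    then have "mv_ideal A (\<Union>C)"
      by (intro ideal_Union_chain) (auto simp: \<F>_def subset_chain_def)
    then show "\<Union>C \<in> \<F>"
      using C by (auto simp: \<F>_def subset_chain_def)
  qed
  then obtain P where "P \<in> \<F>" and P_max: "\<forall>J\<in>\<F>. P \<subseteq> J \<longrightarrow> J = P"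
    by blast
  then have P: "mv_ideal A P" "I \<subseteq> P" "P \<inter> S = {}"
    by (auto simp: \<F>_def)
  have max: "J = P" if "mv_ideal A J" "P \<subseteq> J" "J \<inter> S = {}" for J
  proof -
    have "J \<in> \<F>"
      using that P(2) by (simp add: \<F>_def)
    then show ?thesis
      using P_max that(2) by simp
  qed
  have colon_meets: "\<exists>s\<in>S. s \<sqinter> v \<in> P"
    if "u \<in> carrier A" "v \<in> carrier A" "u \<notin> P" "u \<sqinter> v \<in> P" for u v
  proof -
    let ?J = "{z \<in> carrier A. z \<sqinter> v \<in> P}"
    have "P \<subseteq> ?J"
      using P(1) that ideal_down [OF P(1) _ meet_lower1] by (auto dest: ideal_subset)
    then have "?J \<inter> S \<noteq> {}"
      using max [OF colon_ideal [OF P(1)]] that by blast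
    then show ?thesis
      by blast
  qed
  have "x \<ominus> y \<in> P \<or> y \<ominus> x \<in> P" if xy: "x \<in> carrier A" "y \<in> carrier A" for x y
  proof (rule ccontr)
    assume neg: "\<not> ?thesis"
    have "(x \<ominus> y) \<sqinter> (y \<ominus> x) \<in> P"
      using xy P(1) by (simp add: minus_meet_minus ideal_zero)
    then obtain s where s: "s \<in> S" "s \<sqinter> (y \<ominus> x) \<in> P"
      using colon_meets xy neg by blast
    then have "(y \<ominus> x) \<sqinter> s \<in> P"
      using meet_comm [of s "y \<ominus> x"] xy S by auto
    then obtain t where "t \<in> S" "t \<sqinter> s \<in> P"
      using colon_meets [of "y \<ominus> x" s] xy neg s S by blast
    then show False
      using s S_meet P(3) by blast
  qed
  moreover have "\<one> \<notin> P"
    using P(1,3) S ideal_down [OF P(1), of \<one>] by auto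
  ultimately have "mv_prime_ideal A P"
    using P(1) by (simp add: mv_prime_ideal_def)
  then show ?thesis
    using P that by blast
qed

lemma prime_ideal_separating:
  assumes "mv_ideal A I" "a \<in> carrier A" "a \<notin> I"
  obtains P where "mv_prime_ideal A P" "I \<subseteq> P" "a \<notin> P"
  by (rule prime_ideal_avoiding [of I "{a}"]) (use assms in \<open>auto simp: meet_idem\<close>)

lemma prime_ideal_is_ideal: "mv_prime_ideal A P \<Longrightarrow> mv_ideal A P"
  by (simp add: mv_prime_ideal_def)

lemma spec_ideal: "P \<in> mv_spec A \<Longrightarrow> mv_ideal A P"
  by (simp add: mv_spec_def prime_ideal_is_ideal)

lemma in_all_primes_eq_zero:
  assumes "a \<in> carrier A" "\<And>P. P \<in> mv_spec A \<Longrightarrow> a \<in> P"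
  shows "a = \<zero>"
proof (rule ccontr)
  assume "a \<noteq> \<zero>"
  then obtain P where "mv_prime_ideal A P" "a \<notin> P"
    using prime_ideal_separating [OF zero_ideal] assms(1) by blast
  then show False
    using assms(2) by (simp add: mv_spec_def)
qed

text \<open>The bound \<open>x \<sqsubseteq> (x \<ominus> y) \<oplus> x \<sqinter> y\<close> turns primeness, which is stated in terms of differences,
  into primeness with respect to meets.\<close>

lemma prime_meet_cases:
  assumes P: "mv_prime_ideal A P" and bc: "b \<in> carrier A" "c \<in> carrier A" "b \<sqinter> c \<in> P"
  shows "b \<in> P \<or> c \<in> P"
proof -
  have *: "x \<in> P" if x: "x \<in> carrier A" "y \<in> carrier A" "x \<ominus> y \<in> P" "x \<sqinter> y \<in> P" for x y
  proof -
    have "x \<sqsubseteq> (x \<ominus> y) \<oplus> x \<sqinter> y"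
      using x le_plus_minus [of x y]
      by (intro le_plus_meet) (simp_all add: le_plus_right plus_comm [of "x \<ominus> y"])
    then show ?thesis
      using ideal_down [OF prime_ideal_is_ideal [OF P] ideal_plus [OF prime_ideal_is_ideal [OF P] x(3,4)]] x
      by simp
  qed
  have "b \<ominus> c \<in> P \<or> c \<ominus> b \<in> P"
    using P bc by (simp add: mv_prime_ideal_def)
  then show ?thesis
    using *[of b c] *[of c b] bc meet_comm [of b c] by auto
qed

section \<open>Gluing two elements\<close>

lemma ideal_sum:
  assumes I: "mv_ideal A I" and J: "mv_ideal A J"
  shows "mv_ideal A {x \<in> carrier A. \<exists>i\<in>I. \<exists>j\<in>J. x \<sqsubseteq> i \<oplus> j}" (is "mv_ideal A ?K")
  unfolding mv_ideal_def
proof (intro conjI ballI impI)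
  show "?K \<subseteq> carrier A"
    by auto
  show "\<zero> \<in> ?K"
    using ideal_zero [OF I] ideal_zero [OF J] by force
next
  fix x y assume x: "x \<in> carrier A" "y \<in> ?K" "x \<sqsubseteq> y"
  then obtain i j where "i \<in> I" "j \<in> J" "y \<sqsubseteq> i \<oplus> j" "y \<in> carrier A"
    by blast
  then show "x \<in> ?K"
    using x le_trans [OF x(3), of "i \<oplus> j"] ideal_subset [OF I] ideal_subset [OF J] by blast
next
  fix x y assume "x \<in> ?K" "y \<in> ?K"
  then obtain i j i' j' where ij: "i \<in> I" "j \<in> J" "i' \<in> I" "j' \<in> J"
    "x \<sqsubseteq> i \<oplus> j" "y \<sqsubseteq> i' \<oplus> j'" "x \<in> carrier A" "y \<in> carrier A"
    by blast
  have c: "i \<in> carrier A" "j \<in> carrier A" "i' \<in> carrier A" "j' \<in> carrier A"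
    using ij ideal_subset [OF I] ideal_subset [OF J] by auto
  have "x \<oplus> y \<sqsubseteq> (i \<oplus> j) \<oplus> (i' \<oplus> j')"
    using ij c by (intro plus_mono) auto
  also have "(i \<oplus> j) \<oplus> (i' \<oplus> j') = (i \<oplus> i') \<oplus> (j \<oplus> j')"
    using c by (simp add: plus_ac)
  finally show "x \<oplus> y \<in> ?K"
    using ij ideal_plus [OF I] ideal_plus [OF J] by blast
qed

text \<open>The intersection of all primes containing \<open>b\<close>. It is the ideal generated by \<open>b\<close>, but in
  this form an element of it lies, by definition, in every prime over which the gluing is checked.\<close>

definition kernel_W :: "'a \<Rightarrow> 'a set" where
  "kernel_W b = {x \<in> carrier A. \<forall>P\<in>mv_W A b. x \<in> P}"

lemma kernel_W_ideal: "mv_ideal A (kernel_W b)"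
  unfolding mv_ideal_def
proof (intro conjI ballI impI)
  have ideal: "mv_ideal A P" if "P \<in> mv_W A b" for P
    using that by (simp add: mv_W_def spec_ideal)
  show "kernel_W b \<subseteq> carrier A"
    by (auto simp: kernel_W_def)
  show "\<zero> \<in> kernel_W b"
    by (simp add: kernel_W_def ideal ideal_zero)
  show "x \<in> kernel_W b" if "x \<in> carrier A" "y \<in> kernel_W b" "x \<sqsubseteq> y" for x y
    using that ideal_down [OF ideal] unfolding kernel_W_def by blast
  show "x \<oplus> y \<in> kernel_W b" if "x \<in> kernel_W b" "y \<in> kernel_W b" for x y
    using that by (simp add: kernel_W_def ideal ideal_plus)
qed

text \<open>The sum of the two kernels is an ideal containing \<open>b1\<close> and \<open>b2\<close>; if \<open>d\<close> were outside it, a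
  prime ideal separating \<open>d\<close> from it would contradict the assumption on common primes.\<close>

lemma bound_if_in_common_primes:
  assumes d: "d \<in> carrier A" and b: "b1 \<in> carrier A" "b2 \<in> carrier A"
    and common: "\<And>P. P \<in> mv_W A b1 \<inter> mv_W A b2 \<Longrightarrow> d \<in> P"
  obtains c1 c2 where "c1 \<in> kernel_W b1" "c2 \<in> kernel_W b2" "d \<sqsubseteq> c1 \<oplus> c2"
proof -
  let ?K = "{x \<in> carrier A. \<exists>c1\<in>kernel_W b1. \<exists>c2\<in>kernel_W b2. x \<sqsubseteq> c1 \<oplus> c2}"
  have K: "mv_ideal A ?K"
    by (intro ideal_sum kernel_W_ideal)
  have "b1 \<in> kernel_W b1" "b2 \<in> kernel_W b2" "\<zero> \<in> kernel_W b1" "\<zero> \<in> kernel_W b2"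
    using b ideal_zero [OF kernel_W_ideal] by (auto simp: kernel_W_def mv_W_def)
  moreover have "b1 \<sqsubseteq> b1 \<oplus> \<zero>" "b2 \<sqsubseteq> \<zero> \<oplus> b2"
    using b by simp_all
  ultimately have "b1 \<in> ?K" "b2 \<in> ?K"
    using b by blast+
  have "d \<in> ?K"
  proof (rule ccontr)
    assume "d \<notin> ?K"
    then obtain P where "mv_prime_ideal A P" "?K \<subseteq> P" "d \<notin> P"
      using prime_ideal_separating [OF K d] by blast
    then show False
      using common [of P] \<open>b1 \<in> ?K\<close> \<open>b2 \<in> ?K\<close> by (auto simp: mv_W_def mv_spec_def)
  qed
  then show ?thesis
    using that by blast
qed

text \<open>The glued element is \<open>(s1 \<ominus> c1) \<squnion> (s2 \<ominus> c2)\<close>, where \<open>d s1 s2 \<sqsubseteq> c1 \<oplus> c2\<close>. Modulo a prime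
  containing \<open>c1\<close> the first term is \<open>s1\<close>, and the second one does not exceed it because
  \<open>s2 \<ominus> c2 \<sqsubseteq> s1 \<oplus> c1\<close>.\<close>

lemma binary_gluing:
  assumes s: "s1 \<in> carrier A" "s2 \<in> carrier A" and b: "b1 \<in> carrier A" "b2 \<in> carrier A"
    and agree: "\<And>P. P \<in> mv_W A b1 \<inter> mv_W A b2 \<Longrightarrow> mv_dist A s1 s2 \<in> P"
  obtains s where "s \<in> carrier A"
    "\<And>P. P \<in> mv_W A b1 \<Longrightarrow> mv_dist A s s1 \<in> P"
    "\<And>P. P \<in> mv_W A b2 \<Longrightarrow> mv_dist A s s2 \<in> P"
proof -
  obtain c1 c2 where c: "c1 \<in> kernel_W b1" "c2 \<in> kernel_W b2" "mv_dist A s1 s2 \<sqsubseteq> c1 \<oplus> c2"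
    using bound_if_in_common_primes [OF _ b agree] s by blast
  have cc: "c1 \<in> carrier A" "c2 \<in> carrier A"
    using c by (auto simp: kernel_W_def)
  define s where "s = (s1 \<ominus> c1) \<squnion> (s2 \<ominus> c2)"
  \<comment> \<open>Both congruences are instances of one statement, with the two indices interchanged.\<close>
  have close: "mv_dist A s t \<in> P"
    if t: "t \<in> carrier A" "t' \<in> carrier A" "e \<in> carrier A" "e' \<in> carrier A"
      and s_eq: "s = (t \<ominus> e) \<squnion> (t' \<ominus> e')" and t't: "t' \<ominus> t \<sqsubseteq> e \<oplus> e'"
      and P: "mv_ideal A P" "e \<in> P" for t t' e e' P
  proof -
    have sc: "s \<in> carrier A"
      using t s_eq by simp
    have "t \<sqsubseteq> e \<oplus> (t \<ominus> e)"
      using t by (simp add: le_plus_minus)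
    also have "\<dots> \<sqsubseteq> e \<oplus> s"
      using t unfolding s_eq by (intro plus_mono join_upper1) auto
    finally have "t \<ominus> s \<sqsubseteq> e"
      using t sc by (simp add: minus_le_iff plus_comm)
    moreover have "s \<sqsubseteq> t \<oplus> e"
      unfolding s_eq
    proof (rule join_least)
      show "t \<ominus> e \<sqsubseteq> t \<oplus> e"
        using le_trans [OF minus_le le_plus_right, of t e e] t by simp
      show "t' \<ominus> e' \<sqsubseteq> t \<oplus> e"
        using t't t by (simp add: minus_le_iff plus_ac)
    qed (use t in auto)
    then have "s \<ominus> t \<sqsubseteq> e"
      using t sc by (simp add: minus_le_iff)
    ultimately show ?thesis
      using ideal_down [OF P] t sc P(1) by (simp add: dist_in_ideal_iff)
  qed
  have d: "s1 \<ominus> s2 \<sqsubseteq> mv_dist A s1 s2" "s2 \<ominus> s1 \<sqsubseteq> mv_dist A s1 s2"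
    using s by (auto simp: mv_dist_def le_plus_left le_plus_right)
  show ?thesis
  proof
    show "s \<in> carrier A"
      using s cc by (simp add: s_def)
    show "mv_dist A s s1 \<in> P" if "P \<in> mv_W A b1" for P
    proof (rule close [of s1 s2 c1 c2])
      show "s2 \<ominus> s1 \<sqsubseteq> c1 \<oplus> c2"
        using le_trans [OF d(2) c(3)] s cc by simp
    qed (use that s cc c in \<open>auto simp: s_def kernel_W_def mv_W_def spec_ideal\<close>)
    show "mv_dist A s s2 \<in> P" if "P \<in> mv_W A b2" for P
    proof (rule close [of s2 s1 c2 c1])
      show "s1 \<ominus> s2 \<sqsubseteq> c2 \<oplus> c1"
        using le_trans [OF d(1) c(3)] s cc by (simp add: plus_comm)
    qed (use that s cc c in \<open>auto simp: s_def join_comm kernel_W_def mv_W_def spec_ideal\<close>)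
  qed
qed

section \<open>Sections of the prime spectrum\<close>

lemma mv_W_zero: "mv_W A \<zero> = mv_spec A"
  by (auto simp: mv_W_def spec_ideal ideal_zero)

lemma mv_W_plus: "\<lbrakk>a \<in> carrier A; b \<in> carrier A\<rbrakk> \<Longrightarrow> mv_W A (a \<oplus> b) = mv_W A a \<inter> mv_W A b"
  by (auto simp: mv_W_def spec_ideal ideal_plus_iff)

lemma mv_W_meet:
  assumes "a \<in> carrier A" "b \<in> carrier A"
  shows "mv_W A (a \<sqinter> b) = mv_W A a \<union> mv_W A b"
proof
  show "mv_W A (a \<sqinter> b) \<subseteq> mv_W A a \<union> mv_W A b"
    using prime_meet_cases assms by (auto simp: mv_W_def mv_spec_def)
  show "mv_W A a \<union> mv_W A b \<subseteq> mv_W A (a \<sqinter> b)"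
    using assms by (auto simp: mv_W_def intro: ideal_down [OF spec_ideal] meet_lower1 meet_lower2)
qed

lemma openin_mv_W: "a \<in> carrier A \<Longrightarrow> openin (mv_spec_topology A) (mv_W A a)"
  unfolding mv_spec_topology_def by (rule topology_generated_by_Basis) blast

text \<open>The sets \<open>W b\<close> form a base, not only a subbase, since they are closed under finite
  intersections.\<close>

lemma mv_W_base:
  assumes "openin (mv_spec_topology A) U" "P \<in> U"
  obtains b where "b \<in> carrier A" "P \<in> mv_W A b" "mv_W A b \<subseteq> U"
proof -
  have "generate_topology_on {mv_W A a | a. a \<in> carrier A} U"
    using assms(1) by (simp add: mv_spec_topology_def openin_topology_generated_by_iff)
  then have "\<exists>b\<in>carrier A. P \<in> mv_W A b \<and> mv_W A b \<subseteq> U" if "P \<in> U"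
    using that
  proof (induction arbitrary: P rule: generate_topology_on.induct)
    case (Int U V)
    obtain b where b: "b \<in> carrier A" "P \<in> mv_W A b" "mv_W A b \<subseteq> U"
      using Int by blast
    obtain c where c: "c \<in> carrier A" "P \<in> mv_W A c" "mv_W A c \<subseteq> V"
      using Int by blast
    have "P \<in> mv_W A (b \<oplus> c)" "mv_W A (b \<oplus> c) \<subseteq> U \<inter> V"
      using b c by (auto simp: mv_W_plus)
    then show ?case
      using plus_closed [OF b(1) c(1)] by blast
  next
    case (UN K)
    then show ?case
      by (meson UnionE Union_upper subset_trans)
  qed blast+
  then show ?thesis
    using assms(2) that by blast
qed

lemma hat_eq_iff:
  assumes "P \<in> mv_spec A" "a \<in> carrier A" "c \<in> carrier A"
  shows "mv_hat A a P = mv_hat A c P \<longleftrightarrow> mv_dist A a c \<in> P"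
  using assms by (simp add: mv_hat_def mv_class_eq_iff spec_ideal)

text \<open>Two elements agree on the basic open set given by their distance, so the preimage of a basic
  open set of the bundle under a section coming from \<open>A\<close> is again a basic open set.\<close>

lemma continuous_mv_hat:
  assumes a: "a \<in> carrier A"
  shows "continuous_map (mv_spec_topology A) (mv_etale_topology A) (mv_hat A a)"
  unfolding mv_etale_topology_def
proof (rule continuous_on_generated_topo)
  fix U assume "U \<in> {mv_hat A a ` mv_W A b | a b. a \<in> carrier A \<and> b \<in> carrier A}"
  then obtain c b where cb: "c \<in> carrier A" "b \<in> carrier A" and U: "U = mv_hat A c ` mv_W A b"
    by blast
  have "mv_hat A a P \<in> U \<longleftrightarrow> P \<in> mv_W A b \<and> mv_hat A a P = mv_hat A c P"
    if "P \<in> mv_spec A" for P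
    using that by (auto simp: U mv_hat_def mv_W_def)
  then have "mv_hat A a -` U \<inter> mv_spec A = mv_W A (b \<oplus> mv_dist A a c)"
    using a cb hat_eq_iff [OF _ a cb(1)] unfolding mv_W_plus [OF cb(2) dist_closed [OF a cb(1)]]
    by (simp add: mv_W_def set_eq_iff) blast
  then show "openin (mv_spec_topology A) (mv_hat A a -` U \<inter> topspace (mv_spec_topology A))"
    using a cb by (simp add: topspace_mv_spec_topology [OF mv_algebra_axioms] openin_mv_W)
next
  show "mv_hat A a ` topspace (mv_spec_topology A)
      \<subseteq> \<Union> {mv_hat A a ` mv_W A b | a b. a \<in> carrier A \<and> b \<in> carrier A}"
    using a mv_W_zero zero_closed by (auto simp: topspace_mv_spec_topology [OF mv_algebra_axioms])
qed

lemma mv_hat_in_sections: "a \<in> carrier A \<Longrightarrow> mv_hat A a \<in> carrier (mv_sections A)"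
  using continuous_mv_hat by (simp add: mv_sections_def) (simp add: mv_hat_def mv_proj_def)

lemma inj_on_mv_hat: "inj_on (mv_hat A) (carrier A)"
proof (rule inj_onI)
  fix a c assume ac: "a \<in> carrier A" "c \<in> carrier A" and eq: "mv_hat A a = mv_hat A c"
  have "mv_dist A a c = \<zero>"
    using hat_eq_iff [OF _ ac] eq ac by (intro in_all_primes_eq_zero) auto
  then have "a \<sqsubseteq> c" "c \<sqsubseteq> a"
    using dist_in_ideal_iff [OF zero_ideal ac] by (simp_all add: mv_le_def)
  then show "a = c"
    using ac by (rule le_antisym)
qed

lemma section_locally_hat:
  assumes \<sigma>: "\<sigma> \<in> carrier (mv_sections A)" and P: "P \<in> mv_spec A"
  obtains s b where "s \<in> carrier A" "b \<in> carrier A" "P \<in> mv_W A b"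
    "\<And>Q. Q \<in> mv_W A b \<Longrightarrow> \<sigma> Q = mv_hat A s Q"
proof -
  note top = topspace_mv_spec_topology [OF mv_algebra_axioms]
    topspace_mv_etale_topology [OF mv_algebra_axioms]
  have cont: "continuous_map (mv_spec_topology A) (mv_etale_topology A) \<sigma>"
    and proj: "\<And>Q. Q \<in> mv_spec A \<Longrightarrow> fst (\<sigma> Q) = Q"
    using \<sigma> by (auto simp: mv_sections_def mv_proj_def)
  have "\<sigma> P \<in> mv_etale A"
    using continuous_map_image_subset_topspace [OF cont] P top by auto
  then obtain s where s: "s \<in> carrier A" "\<sigma> P = mv_hat A s P"
    using proj [OF P] P
    by (auto simp: mv_etale_def mv_quot_def quotient_def mv_hat_def mv_class_def prod_eq_iff)
  define V where "V = mv_hat A s ` mv_W A \<zero>"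
  define U where "U = {Q \<in> mv_spec A. \<sigma> Q \<in> V}"
  have "openin (mv_etale_topology A) V"
    unfolding V_def mv_etale_topology_def using s(1) by (intro topology_generated_by_Basis) blast
  then have "openin (mv_spec_topology A) U"
    using openin_continuous_map_preimage [OF cont] top by (simp add: U_def)
  moreover have "P \<in> U"
    using P s by (simp add: U_def V_def mv_W_zero)
  ultimately obtain b where b: "b \<in> carrier A" "P \<in> mv_W A b" "mv_W A b \<subseteq> U"
    by (rule mv_W_base)
  have "\<sigma> Q = mv_hat A s Q" if "Q \<in> mv_W A b" for Q
  proof -
    have "Q \<in> mv_spec A" "\<sigma> Q \<in> V"
      using that b(3) by (auto simp: U_def)
    then show ?thesis
      using proj [of Q] by (auto simp: V_def mv_W_zero mv_hat_def)
  qed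
  then show ?thesis
    using that s(1) b by blast
qed

lemma section_is_hat:
  assumes \<sigma>: "\<sigma> \<in> carrier (mv_sections A)"
  obtains s where "s \<in> carrier A" "\<sigma> = mv_hat A s"
proof -
  define S where "S = {b \<in> carrier A. \<exists>s\<in>carrier A. \<forall>Q\<in>mv_W A b. \<sigma> Q = mv_hat A s Q}"
  have S_meet: "b1 \<sqinter> b2 \<in> S" if b12: "b1 \<in> S" "b2 \<in> S" for b1 b2
  proof -
    obtain s1 s2 where c: "b1 \<in> carrier A" "b2 \<in> carrier A" "s1 \<in> carrier A" "s2 \<in> carrier A"
      and s1: "\<forall>Q\<in>mv_W A b1. \<sigma> Q = mv_hat A s1 Q"
      and s2: "\<forall>Q\<in>mv_W A b2. \<sigma> Q = mv_hat A s2 Q"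
      using b12 unfolding S_def by blast
    have "mv_dist A s1 s2 \<in> Q" if "Q \<in> mv_W A b1 \<inter> mv_W A b2" for Q
    proof -
      have "mv_hat A s1 Q = mv_hat A s2 Q"
        using that s1 s2 by force
      then show ?thesis
        using that c by (simp add: hat_eq_iff mv_W_def)
    qed
    then obtain s where s: "s \<in> carrier A"
      "\<And>P. P \<in> mv_W A b1 \<Longrightarrow> mv_dist A s s1 \<in> P"
      "\<And>P. P \<in> mv_W A b2 \<Longrightarrow> mv_dist A s s2 \<in> P"
      using binary_gluing [OF c(3,4,1,2)] by blast
    have "\<sigma> Q = mv_hat A s Q" if "Q \<in> mv_W A (b1 \<sqinter> b2)" for Q
    proof -
      have "Q \<in> mv_spec A" "Q \<in> mv_W A b1 \<or> Q \<in> mv_W A b2"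
        using that c mv_W_meet by (auto simp: mv_W_def)
      then show ?thesis
        using s s1 s2 hat_eq_iff [OF _ s(1) c(3)] hat_eq_iff [OF _ s(1) c(4)] by metis
    qed
    then show ?thesis
      using c s(1) unfolding S_def by blast
  qed
  have "\<zero> \<in> S"
  proof (rule ccontr)
    assume "\<zero> \<notin> S"
    \<comment> \<open>No prime contains \<open>1\<close>, so the condition on \<open>W 1\<close> is vacuous.\<close>
    moreover have "\<one> \<in> S"
      unfolding S_def by (auto simp: mv_W_def mv_spec_def mv_prime_ideal_def)
    moreover have "S \<subseteq> carrier A"
      by (auto simp: S_def)
    ultimately obtain P where P: "mv_prime_ideal A P" "P \<inter> S = {}"
      using prime_ideal_avoiding [OF zero_ideal _ _ _ S_meet] by blast
    then have "P \<in> mv_spec A"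
      by (simp add: mv_spec_def)
    then obtain s b where "s \<in> carrier A" "b \<in> carrier A" "P \<in> mv_W A b"
      "\<And>Q. Q \<in> mv_W A b \<Longrightarrow> \<sigma> Q = mv_hat A s Q"
      using section_locally_hat [OF \<sigma>] by blast
    then have "b \<in> P \<inter> S"
      by (auto simp: S_def mv_W_def)
    then show False
      using P by simp
  qed
  then have "\<exists>s\<in>carrier A. \<forall>Q\<in>mv_spec A. \<sigma> Q = mv_hat A s Q"
    by (simp add: S_def mv_W_zero)
  then obtain s where s: "s \<in> carrier A" "\<forall>Q\<in>mv_spec A. \<sigma> Q = mv_hat A s Q"
    by (rule bexE)
  have "\<sigma> \<in> extensional (mv_spec A)" "mv_hat A s \<in> extensional (mv_spec A)"
    using \<sigma> by (auto simp: mv_sections_def mv_hat_def)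
  then have "\<sigma> = mv_hat A s"
    by (rule extensionalityI) (use s(2) in simp)
  then show ?thesis
    by (rule that [OF s(1)])
qed

lemma mv_hat_hom: "mv_hat A \<in> mv_hom A (mv_sections A)"
proof -
  have "mv_hat A (x \<oplus> y) = mv_hat A x \<oplus>\<^bsub>mv_sections A\<^esub> mv_hat A y"
    if "x \<in> carrier A" "y \<in> carrier A" for x y
    using that by (auto simp: mv_sections_def mv_hat_def mv_quot_plus_class spec_ideal
        intro!: restrict_ext)
  moreover have "mv_hat A (\<^bold>\<not> x) = \<^bold>\<not>\<^bsub>mv_sections A\<^esub> mv_hat A x" if "x \<in> carrier A" for x
    using that by (auto simp: mv_sections_def mv_hat_def mv_quot_neg_class spec_ideal
        intro!: restrict_ext)
  moreover have "mv_hat A \<zero> = \<zero>\<^bsub>mv_sections A\<^esub>"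
    by (simp add: mv_sections_def mv_hat_def mv_quot_def)
  ultimately show ?thesis
    using mv_hat_in_sections by (simp add: mv_hom_def)
qed

lemma mv_hat_iso: "mv_hat A \<in> mv_iso A (mv_sections A)"
proof -
  have "mv_hat A ` carrier A = carrier (mv_sections A)"
    using mv_hat_in_sections section_is_hat by blast
  then show ?thesis
    by (simp add: mv_iso_def mv_hat_hom bij_betw_def inj_on_mv_hat)
qed

end

lemma mv_algebra_iso_image:
  assumes "mv_algebra A" and h: "h \<in> mv_iso A B"
  shows "mv_algebra B"
proof -
  interpret mv_algebra A by fact
  have surj: "carrier B = h ` carrier A"
    using h by (simp add: mv_iso_def bij_betw_def)
  have hom: "x \<in> carrier A \<Longrightarrow> y \<in> carrier A \<Longrightarrow> h x \<oplus>\<^bsub>B\<^esub> h y = h (x \<oplus>\<^bsub>A\<^esub> y)"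
    "x \<in> carrier A \<Longrightarrow> \<^bold>\<not>\<^bsub>B\<^esub> h x = h (\<^bold>\<not>\<^bsub>A\<^esub> x)" "\<zero>\<^bsub>B\<^esub> = h \<zero>\<^bsub>A\<^esub>" for x y
    using h by (auto simp: mv_iso_def mv_hom_def)
  show ?thesis
    by unfold_locales
      (auto simp: surj hom plus_assoc plus_neg_zero luk intro!: arg_cong [where f = h] intro: plus_comm)
qed

theorem theorem3p12:
  fixes A :: "('a, 'm) mv_scheme"
  assumes "mv_algebra A"
  shows "mv_algebra (mv_sections A) \<and> mv_hat A \<in> mv_iso A (mv_sections A)"
  using mv_algebra.mv_hat_iso [OF assms] mv_algebra_iso_image [OF assms] by blast

end
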